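(* Let $X$ be a uniformly convex and uniformly smooth Banach space and let $K$ be a closed and convex cone in $X$ with vertex at $v$. Then $$K_\pi^{\perp}=\pi_K^{-1}(v)=Jv+\mathcal{F}_K^{-1}(v).$$
   Context: Banach spaces are real; $X^*$ is the dual of $X$ and $\langle\cdot,\cdot\rangle$ is the duality pairing between $X^*$ and $X$. The normalized duality mapping $J:X\to X^*$ is the single-valued map determined by $\langle Jx,x\rangle=\|Jx\|_{X^*}^2=\|x\|_X^2$. A cone with vertex $v$ is a set $K$ containing $v$ such that $v+t(x-v)\in K$ for all $x\in K$, $t\ge0$. The generalized dual cone is $K_\pi^{\perp}=\{\psi\in X^*:\langle\psi-Jv,v-z\rangle\ge0\ \text{for all }z\in K\}$. The generalized projection $\pi_K:X^*\to K$ sends $\psi$ to the unique minimizer over $y\in K$ of $V(\psi,y)=\|\psi\|_{X^*}^2-2\langle\psi,y\rangle+\|y\|_X^2$, and $\pi_K^{-1}(v)=\{\psi\in X^*:\pi_K(\psi)=v\}$. The vision of $v$ in $X^*$ with respect to $K$ is $\mathcal{F}_K^{-1}(v)=\{\psi\in X^*:\langle\psi,v\rangle=\sup_{x\in K}\langle\psi,x\rangle\}$. *)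

theory Defs
  imports "HOL-Analysis.Analysis"
begin

text \<open>A real Banach space \<open>X\<close> is a type of class \<open>banach\<close>; its dual is the type
  \<open>'a \<Rightarrow>\<^sub>L real\<close> with the operator norm, and \<open>\<langle>\<psi>, x\<rangle>\<close> is \<open>blinfun_apply \<psi> x\<close>.\<close>

definition uniformly_convex :: "'a::real_normed_vector itself \<Rightarrow> bool" where
  "uniformly_convex _ \<longleftrightarrow>
     (\<forall>\<epsilon>>0. \<exists>\<delta>>0. \<forall>x y :: 'a.
        norm x = 1 \<and> norm y = 1 \<and> norm (x - y) \<ge> \<epsilon> \<longrightarrow> norm ((1/2) *\<^sub>R (x + y)) \<le> 1 - \<delta>)"

text \<open>Equivalently, the modulus of smoothness
  \<open>\<rho>(t) = sup {(\<parallel>x + y\<parallel> + \<parallel>x - y\<parallel>) / 2 - 1 | \<parallel>x\<parallel> = 1, \<parallel>y\<parallel> = t}\<close> satisfies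
  \<open>\<rho>(t) / t \<rightarrow> 0\<close> as \<open>t \<rightarrow> 0+\<close>; the form below also makes sense for the zero space.\<close>
definition uniformly_smooth :: "'a::real_normed_vector itself \<Rightarrow> bool" where
  "uniformly_smooth _ \<longleftrightarrow>
     (\<forall>\<epsilon>>0. \<exists>\<delta>>0. \<forall>x y :: 'a.
        norm x = 1 \<and> norm y \<le> \<delta> \<longrightarrow> norm (x + y) + norm (x - y) \<le> 2 + \<epsilon> * norm y)"

definition duality_map :: "'a::real_normed_vector \<Rightarrow> ('a \<Rightarrow>\<^sub>L real)" where
  "duality_map x =
     (THE j. blinfun_apply j x = (norm j)\<^sup>2 \<and> (norm j)\<^sup>2 = (norm x)\<^sup>2)"

definition cone_with_vertex :: "'a::real_vector set \<Rightarrow> 'a \<Rightarrow> bool" where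
  "cone_with_vertex K v \<longleftrightarrow> v \<in> K \<and> (\<forall>x\<in>K. \<forall>t\<ge>0. v + t *\<^sub>R (x - v) \<in> K)"

definition gen_dual_cone ::
  "'a::real_normed_vector set \<Rightarrow> 'a \<Rightarrow> ('a \<Rightarrow>\<^sub>L real) set" where
  "gen_dual_cone K v = {\<psi>. \<forall>z\<in>K. blinfun_apply (\<psi> - duality_map v) (v - z) \<ge> 0}"

definition lyapunov :: "('a::real_normed_vector \<Rightarrow>\<^sub>L real) \<Rightarrow> 'a \<Rightarrow> real" where
  "lyapunov \<psi> y = (norm \<psi>)\<^sup>2 - 2 * blinfun_apply \<psi> y + (norm y)\<^sup>2"

definition gen_proj :: "'a::real_normed_vector set \<Rightarrow> ('a \<Rightarrow>\<^sub>L real) \<Rightarrow> 'a" where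
  "gen_proj K \<psi> = (THE y. y \<in> K \<and> (\<forall>z\<in>K. lyapunov \<psi> y \<le> lyapunov \<psi> z))"

text \<open>The supremum is taken in the extended reals, since \<open>\<psi>\<close> may be unbounded above on \<open>K\<close>.\<close>
definition vision :: "'a::real_normed_vector set \<Rightarrow> 'a \<Rightarrow> ('a \<Rightarrow>\<^sub>L real) set" where
  "vision K v = {\<psi>. ereal (blinfun_apply \<psi> v) = (SUP x\<in>K. ereal (blinfun_apply \<psi> x))}"

end

theory Submission
  imports Defs
begin

text \<open>Uniform smoothness makes the norm differentiable away from \<open>0\<close>; the derivative supplies the
  functional \<open>Jv\<close> (so the Hahn--Banach theorem is not needed), and \<open>2 Jv\<close> is the derivative of the
  squared norm at \<open>v\<close>. Hence \<open>V(\<psi>, \<cdot>)\<close> is a convex function with derivative \<open>-2(\<psi> - Jv)\<close> at \<open>v\<close>, and \<open>v\<close>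
  minimises it over \<open>K\<close> iff \<open>\<langle>\<psi> - Jv, v - z\<rangle> \<ge> 0\<close> on \<open>K\<close>, i.e. iff \<open>\<psi> - Jv\<close> attains its supremum over
  \<open>K\<close> at \<open>v\<close>. Uniform convexity makes minimising sequences Cauchy, so that
  the minimiser exists and is unique.\<close>

section \<open>The duality map and differentiability of the norm\<close>

text \<open>The definition concerns unit vectors; scaling by \<open>norm v\<close> carries it to any
  nonzero point, with the radius scaled and \<open>e\<close> unchanged.\<close>

lemma uniformly_smoothD:
  fixes v :: "'a::real_normed_vector"
  assumes "uniformly_smooth TYPE('a)" "v \<noteq> 0" "e > 0"
  obtains d where "d > 0"
    "\<And>k. norm k \<le> d \<Longrightarrow> norm (v + k) + norm (v - k) \<le> 2 * norm v + e * norm k"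
proof -
  obtain d where d: "d > 0"
    "\<And>x y::'a. norm x = 1 \<Longrightarrow> norm y \<le> d \<Longrightarrow> norm (x + y) + norm (x - y) \<le> 2 + e * norm y"
    using assms unfolding uniformly_smooth_def by metis
  let ?r = "norm v"
  have r: "?r > 0" using assms by simp
  show thesis
  proof (rule that[of "d * ?r"])
    show "d * ?r > 0" using d r by simp
    fix k :: 'a assume k: "norm k \<le> d * ?r"
    have "norm (v /\<^sub>R ?r + k /\<^sub>R ?r) + norm (v /\<^sub>R ?r - k /\<^sub>R ?r) \<le> 2 + e * norm (k /\<^sub>R ?r)"
      using k r by (intro d(2)) (simp_all add: field_simps)
    then have "norm (v + k) / ?r + norm (v - k) / ?r \<le> 2 + e * (norm k / ?r)"
      by (simp add: divide_inverse_commute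
          flip: scaleR_add_right scaleR_diff_right)
    then show "norm (v + k) + norm (v - k) \<le> 2 * ?r + e * norm k"
      using mult_right_mono[of _ _ ?r] r by (fastforce simp: distrib_right)
  qed
qed

text \<open>A supporting functional bounds the increment of the norm from below. Bounding
  \<open>norm (v - k)\<close> below by \<open>g\<close> as well turns the smoothness estimate into
  the matching upper bound.\<close>

lemma norm_has_derivative_supporting_functional:
  fixes v :: "'a::real_normed_vector"
  assumes us: "uniformly_smooth TYPE('a)" and v: "v \<noteq> 0"
    and g: "bounded_linear g" "g v = norm v" "\<And>x. g x \<le> norm x"
  shows "(norm has_derivative g) (at v)"
  unfolding has_derivative_within_alt
proof (intro conjI allI impI g(1))
  interpret bounded_linear g by fact
  fix e :: real assume "e > 0"
  then obtain d where d: "d > 0"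
    "\<And>k. norm k \<le> d \<Longrightarrow> norm (v + k) + norm (v - k) \<le> 2 * norm v + e * norm k"
    using uniformly_smoothD[OF us v] by blast
  have "norm (norm y - norm v - g (y - v)) \<le> e * norm (y - v)" if "norm (y - v) < d" for y
  proof -
    have "norm y + norm (v - (y - v)) \<le> 2 * norm v + e * norm (y - v)"
      using d(2)[of "y - v"] that by simp
    moreover have "g (v - (y - v)) \<le> norm (v - (y - v))" "g y \<le> norm y"
      using g(3) by blast+
    moreover have "g (v - (y - v)) = norm v - g (y - v)" "g y = norm v + g (y - v)"
      by (simp_all add: diff g(2))
    ultimately show ?thesis by auto
  qed
  then show "\<exists>d>0. \<forall>y\<in>UNIV. norm (y - v) < d \<longrightarrow>
      norm (norm y - norm v - g (y - v)) \<le> e * norm (y - v)"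
    using d(1) by blast
qed

text \<open>The functional is the one-sided directional derivative of the norm at \<open>v\<close>, which is sublinear
  by convexity and odd by smoothness.\<close>
lemma supporting_functional_exists:
  fixes v :: "'a::real_normed_vector"
  assumes us: "uniformly_smooth TYPE('a)" and v: "v \<noteq> 0"
  obtains g where "bounded_linear g" "g v = norm v" "\<And>x. \<bar>g x\<bar> \<le> norm x"
proof -
  \<comment> \<open>\<open>p h\<close> is the limit of \<open>q h t\<close> as \<open>t\<close>
    decreases to 0, since by convexity the quotients increase with \<open>t\<close>.\<close>
  define q where "q h t = (norm (v + t *\<^sub>R h) - norm v) / t" for h and t :: real
  define p where "p h = Inf (q h ` {0<..})" for h
  have abs_q: "\<bar>q h t\<bar> \<le> norm h" if "t > 0" for h t
  proof -
    have "\<bar>norm (v + t *\<^sub>R h) - norm v\<bar> \<le> t * norm h"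
      using norm_triangle_ineq3[of "v + t *\<^sub>R h" v] that by simp
    then show ?thesis using that by (simp add: q_def field_simps)
  qed
  have bdd: "bdd_below (q h ` {0<..})" for h
    using abs_q[of _ h] by (intro bdd_belowI[of _ "- norm h"]) (force simp: abs_le_iff)
  have p_le: "p h \<le> q h t" if "t > 0" for h t
    unfolding p_def using that by (intro cInf_lower bdd) auto
  have le_p: "c \<le> p h" if "\<And>t. t > 0 \<Longrightarrow> c \<le> q h t" for c h
    unfolding p_def using that by (intro cInf_greatest) auto
  have q_mono: "q h s \<le> q h t" if "0 < s" "s \<le> t" for h s t
  proof -
    have "v + s *\<^sub>R h = (1 - s/t) *\<^sub>R v + (s/t) *\<^sub>R (v + t *\<^sub>R h)"
      using that by (simp add: algebra_simps)
    then have "norm (v + s *\<^sub>R h) \<le> (1 - s/t) * norm v + (s/t) * norm (v + t *\<^sub>R h)"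
      using norm_triangle_ineq[of "(1 - s/t) *\<^sub>R v" "(s/t) *\<^sub>R (v + t *\<^sub>R h)"] that by simp
    then show ?thesis using that by (simp add: q_def field_simps)
  qed
  \<comment> \<open>By monotonicity, a \<open>t0\<close> with quotient close to the infimum can be
    replaced by any smaller \<open>t\<close>, so two directions can share one
    \<open>t\<close>.\<close>
  have near: "\<exists>t0>0. \<forall>t. 0 < t \<and> t \<le> t0 \<longrightarrow> q h t < p h + e" if "e > 0" for h e
  proof -
    have "\<not> (\<forall>t>0. p h + e \<le> q h t)" using that le_p[of "p h + e" h] by auto
    then obtain t0 where "t0 > 0" "q h t0 < p h + e" by (auto simp: not_le)
    then show ?thesis using q_mono by (meson le_less_trans)
  qed
  have sub: "p (h + k) \<le> p h + p k" for h k
  proof (rule field_le_epsilon)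
    fix e :: real assume "e > 0"
    then obtain a b where "a > 0" "b > 0"
      and a: "\<And>t. 0 < t \<Longrightarrow> t \<le> a \<Longrightarrow> q h t < p h + e/2"
      and b: "\<And>t. 0 < t \<Longrightarrow> t \<le> b \<Longrightarrow> q k t < p k + e/2"
      using near[of "e/2"] by (metis half_gt_zero)
    define t where "t = min a b / 2"
    have t: "t > 0" "2 * t \<le> a" "2 * t \<le> b" using \<open>a > 0\<close> \<open>b > 0\<close> by (auto simp: t_def)
    \<comment> \<open>The sum of the directions is reached as a midpoint, hence the doubled steps
      along \<open>h\<close> and \<open>k\<close> and the halving in the choice of
      \<open>t\<close>.\<close>
    have "v + t *\<^sub>R (h + k) = (1/2) *\<^sub>R ((v + (2*t) *\<^sub>R h) + (v + (2*t) *\<^sub>R k))"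
      by (simp add: algebra_simps flip: scaleR_add_left)
    then have "norm (v + t *\<^sub>R (h + k)) \<le> (norm (v + (2*t) *\<^sub>R h) + norm (v + (2*t) *\<^sub>R k)) / 2"
      using norm_triangle_ineq[of "v + (2*t) *\<^sub>R h" "v + (2*t) *\<^sub>R k"] by simp
    then have "q (h + k) t \<le>
        ((norm (v + (2*t) *\<^sub>R h) + norm (v + (2*t) *\<^sub>R k)) / 2 - norm v) / t"
      unfolding q_def using t(1) by (intro divide_right_mono) auto
    also have "\<dots> = q h (2*t) + q k (2*t)"
      using t(1) by (simp add: q_def field_simps)
    finally show "p (h + k) \<le> p h + p k + e"
      using a[of "2*t"] b[of "2*t"] p_le[of t "h + k"] t by linarith
  qed
  have abs_p: "\<bar>p h\<bar> \<le> norm h" for h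
  proof -
    have "- norm h \<le> q h t" if "t > 0" for t using abs_q[OF that, of h] by linarith
    then have "- norm h \<le> p h" by (rule le_p)
    then show ?thesis using p_le[of 1 h] abs_q[of 1 h] by simp
  qed
  have odd: "p (- h) = - p h" for h
  proof (rule antisym)
    show "- p h \<le> p (- h)" using sub[of h "- h"] abs_p[of 0] by simp
    \<comment> \<open>The added 1 avoids division by 0 when \<open>h = 0\<close>; the bound serves
      both \<open>e'\<close> and \<open>t\<close>.\<close>
    have frac: "c / (norm h + 1) > 0 \<and> c / (norm h + 1) * norm h \<le> c" if "c > 0" for c
    proof -
      have "norm h + 1 > 0" using norm_ge_zero[of h] by linarith
      then show ?thesis using that by (simp add: pos_divide_le_eq distrib_left)
    qed
    have "p h + p (- h) \<le> 0 + e" if e: "e > 0" for e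
    proof -
      define e' where "e' = e / (norm h + 1)"
      have e': "e' > 0" "e' * norm h \<le> e"
        using frac[OF e] by (simp_all add: e'_def)
      obtain d where d: "d > 0"
        "\<And>k. norm k \<le> d \<Longrightarrow> norm (v + k) + norm (v - k) \<le> 2 * norm v + e' * norm k"
        using uniformly_smoothD[OF us v e'(1)] by blast
      define t where "t = d / (norm h + 1)"
      have t: "t > 0" "t * norm h \<le> d"
        using frac[OF d(1)] by (simp_all add: t_def)
      have "norm (v + t *\<^sub>R h) + norm (v - t *\<^sub>R h) \<le> 2 * norm v + e' * (t * norm h)"
        using d(2)[of "t *\<^sub>R h"] t by simp
      \<comment> \<open>The symmetric second difference divided by \<open>t\<close> equals
        \<open>q h t + q (- h) t\<close>.\<close>
      then have "(norm (v + t *\<^sub>R h) + norm (v - t *\<^sub>R h) - 2 * norm v) / t \<le> e' * norm h"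
        unfolding pos_divide_le_eq[OF t(1)] by (simp add: ac_simps)
      then have "q h t + q (- h) t \<le> e' * norm h"
        by (simp add: q_def flip: add_divide_distrib)
      then show ?thesis using p_le[OF t(1), of h] p_le[OF t(1), of "- h"] e'(2) by linarith
    qed
    then have "p h + p (- h) \<le> 0" by (rule field_le_epsilon)
    then show "p (- h) \<le> - p h" by simp
  qed
  \<comment> \<open>Superadditivity comes from \<open>h = (h + k) + (- k)\<close> and
    oddness.\<close>
  have add: "p (h + k) = p h + p k" for h k
    using sub[of h k] sub[of "h + k" "- k"] odd[of k] by simp
  have scale_le: "p (c *\<^sub>R h) \<le> c * p h" if "c > 0" for c h
  proof -
    have "p (c *\<^sub>R h) / c \<le> q h t" if "t > 0" for t
      using p_le[of "t / c" "c *\<^sub>R h"] that \<open>c > 0\<close> by (simp add: q_def field_simps)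
    then have "p (c *\<^sub>R h) / c \<le> p h" by (rule le_p)
    then show ?thesis using that by (simp add: field_simps)
  qed
  have scale_pos: "p (c *\<^sub>R h) = c * p h" if "c > 0" for c h
    using scale_le[OF that, of h] scale_le[of "inverse c" "c *\<^sub>R h"] that
    by (simp add: field_simps)
  have scale: "p (c *\<^sub>R h) = c * p h" for c h
  proof -
    consider "c > 0" | "c = 0" | "c < 0" by linarith
    then show ?thesis
    proof cases
      case 3
      then show ?thesis using scale_pos[of "- c" h] odd[of "c *\<^sub>R h"] by simp
    qed (use scale_pos abs_p[of 0] in auto)
  qed
  have "q v t = norm v" if "t > 0" for t
  proof -
    have "norm (v + t *\<^sub>R v) = norm ((1 + t) *\<^sub>R v)" by (simp add: scaleR_add_left)
    also have "\<dots> = (1 + t) * norm v" using that by simp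
    finally show ?thesis using that by (simp add: q_def field_simps)
  qed
  then have "p v = norm v"
    using le_p[of "norm v" v] p_le[of 1 v] by force
  moreover have "bounded_linear p"
    using add scale abs_p by (intro bounded_linear_intro[where K = 1]) auto
  ultimately show thesis using that abs_p by blast
qed

text \<open>Every candidate for the value of \<open>duality_map\<close> at \<open>v\<close> is,
  after division by \<open>norm v\<close>, a supporting functional. Uniqueness of derivatives then
  leaves only one candidate.\<close>

lemma norm_has_derivative_normalized_functional:
  fixes v :: "'a::real_normed_vector" and j :: "'a \<Rightarrow>\<^sub>L real"
  assumes "uniformly_smooth TYPE('a)" "v \<noteq> 0" "blinfun_apply j v = (norm v)\<^sup>2" "norm j = norm v"
  shows "(norm has_derivative (\<lambda>x. blinfun_apply j x / norm v)) (at v)"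
proof (rule norm_has_derivative_supporting_functional[OF assms(1,2)])
  show "bounded_linear (\<lambda>x. blinfun_apply j x / norm v)"
    using bounded_linear_divide[THEN bounded_linear_compose] blinfun.bounded_linear_right by blast
  show "blinfun_apply j v / norm v = norm v"
    using assms by (simp add: power2_eq_square)
  show "blinfun_apply j x / norm v \<le> norm x" for x
    using norm_blinfun[of j x] assms by (simp add: field_simps)
qed

text \<open>The definite description is justified here: for \<open>v \<noteq> 0\<close>,
  \<open>norm v\<close> times a supporting functional is a candidate, and any two candidates yield
  the same derivative of the norm.\<close>

lemma duality_map:
  fixes v :: "'a::real_normed_vector"
  assumes us: "uniformly_smooth TYPE('a)"
  shows duality_map_apply_self: "blinfun_apply (duality_map v) v = (norm v)\<^sup>2"
    and norm_duality_map: "norm (duality_map v) = norm v"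
proof -
  let ?P = "\<lambda>j. blinfun_apply j v = (norm j)\<^sup>2 \<and> (norm j)\<^sup>2 = (norm v)\<^sup>2"
  have "\<exists>!j. ?P j"
  proof (cases "v = 0")
    case True
    then show ?thesis by auto
  next
    case False
    obtain g where g: "bounded_linear g" "g v = norm v" "\<And>x. \<bar>g x\<bar> \<le> norm x"
      using supporting_functional_exists[OF us False] by blast
    have app: "blinfun_apply (Blinfun g) x = g x" for x
      using g(1) by (simp add: bounded_linear_Blinfun_apply)
    have "norm (Blinfun g) \<le> 1" using g(3) by (intro norm_blinfun_bound) (simp_all add: app)
    moreover have "1 \<le> norm (Blinfun g)"
      using norm_blinfun[of "Blinfun g" v] False by (simp add: app g(2))
    ultimately have "norm (Blinfun g) = 1" by simp
    then have "?P (norm v *\<^sub>R Blinfun g)"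
      by (simp add: scaleR_blinfun.rep_eq app g(2) power2_eq_square)
    moreover have "j = k" if "?P j" "?P k" for j k
    proof (rule blinfun_eqI)
      fix x
      have "(\<lambda>x. blinfun_apply j x / norm v) = (\<lambda>x. blinfun_apply k x / norm v)"
        using that norm_has_derivative_normalized_functional[OF us False]
        by (intro has_derivative_unique[of norm _ v]) (auto simp: power2_eq_iff_nonneg)
      then show "blinfun_apply j x = blinfun_apply k x"
        using False by (auto dest: fun_cong[of _ _ x])
    qed
    ultimately show ?thesis by blast
  qed
  then have "?P (duality_map v)" unfolding duality_map_def by (rule theI')
  then show "blinfun_apply (duality_map v) v = (norm v)\<^sup>2" "norm (duality_map v) = norm v"
    by (auto simp: power2_eq_iff_nonneg)
qed

text \<open>The chain rule factor \<open>2 * norm v\<close> cancels the division by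
  \<open>norm v\<close>. At 0 the square is of second order and
  \<open>duality_map 0 = 0\<close>.\<close>

lemma norm_square_has_derivative:
  fixes v :: "'a::real_normed_vector"
  assumes us: "uniformly_smooth TYPE('a)"
  shows "((\<lambda>x. (norm x)\<^sup>2) has_derivative (\<lambda>h. 2 * blinfun_apply (duality_map v) h)) (at v)"
proof (cases "v = 0")
  case True
  have "((\<lambda>x::'a. (norm x)\<^sup>2) has_derivative (\<lambda>h. 0)) (at 0)"
    unfolding has_derivative_within_alt
    by (auto simp: power2_eq_square intro!: mult_right_mono intro: less_imp_le)
  moreover have "duality_map v = 0" using norm_duality_map[OF us, of v] True by simp
  ultimately show ?thesis using True by simp
next
  case False
  show ?thesis
    by (rule has_derivative_eq_rhs[OF has_derivative_power[OF
          norm_has_derivative_normalized_functional[OF us False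
            duality_map_apply_self[OF us] norm_duality_map[OF us]]]])
      (use False in \<open>simp add: fun_eq_iff\<close>)
qed

section \<open>Existence and uniqueness of the generalized projection\<close>

text \<open>A small midpoint gap of the squared norm forces nearly equal norms, by strict convexity
  of the real square, and then nearly equal directions, by uniform convexity.\<close>

lemma uniformly_convex_square_gap:
  assumes uc: "uniformly_convex TYPE('a::real_normed_vector)" and e: "e > 0" and R: "R > 0"
  obtains s where "s > 0"
    "\<And>x y::'a. \<lbrakk>norm x \<le> R; norm y \<le> R;
       ((norm x)\<^sup>2 + (norm y)\<^sup>2) / 2 - (norm ((1/2) *\<^sub>R (x + y)))\<^sup>2 < s\<rbrakk> \<Longrightarrow> norm (x - y) < e"
proof -
  \<comment> \<open>Vectors of equal norm \<open>a \<le> R\<close> that are \<open>e / 2\<close>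
    apart are at least \<open>e / (2 * R)\<close> apart after normalization.\<close>
  obtain d where d: "d > 0" "\<And>x y::'a. norm x = 1 \<Longrightarrow> norm y = 1 \<Longrightarrow> norm (x - y) \<ge> e / (2 * R)
       \<Longrightarrow> norm ((1/2) *\<^sub>R (x + y)) \<le> 1 - d"
    using uc e R unfolding uniformly_convex_def by (metis divide_pos_pos mult_pos_pos zero_less_numeral)
  \<comment> \<open>The first bound keeps \<open>x\<close> at distance \<open>e / 2\<close> from the
    rescaled \<open>y\<close>; the second makes \<open>4 * s < a * d\<close> in the final
    contradiction.\<close>
  define s where "s = min (e / 16) (e * d / 16)"
  have s: "s > 0" "s \<le> e / 16" "s \<le> e * d / 16" using e d by (auto simp: s_def)
  have ordered: "norm (x - y) < e"
    if xy: "norm x \<le> R" "norm y \<le> norm x"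
      and gap: "((norm x)\<^sup>2 + (norm y)\<^sup>2) / 2 - (norm ((1/2) *\<^sub>R (x + y)))\<^sup>2 < s\<^sup>2" for x y :: 'a
  proof (rule ccontr)
    assume "\<not> norm (x - y) < e"
    then have far: "norm (x - y) \<ge> e" by simp
    define a b m where "a = norm x" and "b = norm y" and "m = norm ((1/2) *\<^sub>R (x + y))"
    have a: "a \<ge> e / 2" "b \<le> a" "a \<le> R"
      using norm_triangle_ineq4[of x y] far xy by (auto simp: a_def b_def)
    have m: "0 \<le> m" "m \<le> (a + b) / 2"
      using norm_triangle_ineq[of x y] by (auto simp: a_def b_def m_def)
    have gap': "(a\<^sup>2 + b\<^sup>2) / 2 - m\<^sup>2 < s\<^sup>2" using gap by (simp add: a_def b_def m_def)
    have "m\<^sup>2 \<le> ((a + b) / 2)\<^sup>2" using m by (intro power_mono)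
    moreover have "(a\<^sup>2 + b\<^sup>2) / 2 - ((a + b) / 2)\<^sup>2 = ((a - b) / 2)\<^sup>2"
      by (simp add: power2_eq_square field_simps)
    ultimately have "((a - b) / 2)\<^sup>2 < s\<^sup>2" using gap' by linarith
    then have ab: "a - b < 2 * s"
      using s(1) power_less_imp_less_base[of "(a - b) / 2" 2 s] by simp
    have b: "b > s" using ab a s e by linarith
    \<comment> \<open>As \<open>b\<close> is the smaller norm, \<open>b\<^sup>2\<close> is at most
      the mean of the squares, so the midpoint norm \<open>m\<close> stays above
      \<open>b - s\<close>.\<close>
    have "b\<^sup>2 \<le> a\<^sup>2" using a b s by (intro power_mono) auto
    then have "b\<^sup>2 - s\<^sup>2 < m\<^sup>2" using gap' unfolding add_divide_distrib by linarith
    moreover have "(b - s)\<^sup>2 \<le> b\<^sup>2 - s\<^sup>2"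
      using mult_left_mono[of s b s] b s by (simp add: power2_eq_square algebra_simps)
    ultimately have "b - s < m" using power_less_imp_less_base[of "b - s" 2 m] m by linarith
    \<comment> \<open>\<open>y\<close> is moved radially onto the sphere through \<open>x\<close>,
      where uniform convexity applies after normalization; the move costs
      \<open>a - b < 2 * s\<close>.\<close>
    define z where "z = (a / b) *\<^sub>R y"
    have pos: "a > 0" "b > 0" using a b e s by auto
    have z: "norm z = a" using pos by (simp add: z_def b_def)
    have "z - y = (a / b - 1) *\<^sub>R y" by (simp add: z_def algebra_simps)
    then have zy: "norm (z - y) = a - b"
      using pos a by (simp add: b_def[symmetric] field_simps)
    have "norm (x - z) \<ge> e / 2"
      using norm_triangle_ineq[of "x - z" "z - y"] zy far ab s e by simp
    moreover have "e / (2 * R) \<le> (e / 2) / a" using a e pos R by (simp add: field_simps)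
    ultimately have "e / (2 * R) \<le> norm (x - z) / a"
      using pos by (meson divide_right_mono less_imp_le order_trans)
    then have "norm ((1/2) *\<^sub>R (x /\<^sub>R a + z /\<^sub>R a)) \<le> 1 - d"
    proof (intro d(2))
      show "norm (x /\<^sub>R a) = 1" "norm (z /\<^sub>R a) = 1" using pos z by (simp_all add: a_def)
      have "norm (x /\<^sub>R a - z /\<^sub>R a) = norm (x - z) / a"
        using pos by (simp add: divide_inverse_commute flip: scaleR_diff_right)
      then show "e / (2 * R) \<le> norm (x /\<^sub>R a - z /\<^sub>R a)"
        using \<open>e / (2 * R) \<le> norm (x - z) / a\<close> by simp
    qed
    moreover have "norm (x /\<^sub>R a + z /\<^sub>R a) = norm (x + z) / a"
      using pos by (simp add: divide_inverse_commute flip: scaleR_add_right)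
    ultimately have "norm (x + z) / 2 / a \<le> 1 - d" by simp
    then have "norm (x + z) / 2 \<le> a - a * d"
      unfolding pos_divide_le_eq[OF pos(1)] by (simp add: algebra_simps)
    moreover have "norm (x + y) \<le> norm (x + z) + norm (z - y)"
      using norm_triangle_ineq4[of "x + z" "z - y"] by simp
    then have "m \<le> norm (x + z) / 2 + s" using zy ab by (simp add: m_def)
    moreover have "e / 2 * d \<le> a * d" using a d by (intro mult_right_mono) auto
    \<comment> \<open>Now \<open>b - s < m \<le> a - a * d + s\<close> gives
      \<open>a * d < 4 * s\<close>, against \<open>a * d \<ge> e * d / 2\<close>.\<close>
    ultimately show False using \<open>b - s < m\<close> ab s by linarith
  qed
  show thesis
  proof (rule that[of "s\<^sup>2"])
    show "s\<^sup>2 > 0" using s by simp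
    fix x y :: 'a
    assume "norm x \<le> R" "norm y \<le> R"
      "((norm x)\<^sup>2 + (norm y)\<^sup>2) / 2 - (norm ((1/2) *\<^sub>R (x + y)))\<^sup>2 < s\<^sup>2"
    then show "norm (x - y) < e"
      using ordered[of x y] ordered[of y x] by (cases "norm y \<le> norm x")
        (auto simp: add.commute norm_minus_commute)
  qed
qed

text \<open>The terms affine in the second argument cancel, so \<open>lyapunov \<psi>\<close>
  inherits the convexity gap of the squared norm.\<close>

lemma lyapunov_midpoint:
  "(lyapunov \<psi> x + lyapunov \<psi> y) / 2 - lyapunov \<psi> ((1/2) *\<^sub>R (x + y)) =
     ((norm x)\<^sup>2 + (norm y)\<^sup>2) / 2 - (norm ((1/2) *\<^sub>R (x + y)))\<^sup>2"
  by (simp add: lyapunov_def blinfun.add_right blinfun.scaleR_right field_simps)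

text \<open>This yields nonnegativity and the boundedness of the sublevel sets of
  \<open>lyapunov \<psi>\<close>.\<close>

lemma lyapunov_ge: "(norm \<psi> - norm y)\<^sup>2 \<le> lyapunov \<psi> y"
  using norm_blinfun[of \<psi> y] by (simp add: lyapunov_def power2_diff abs_le_iff)

lemma lyapunov_ge_0: "0 \<le> lyapunov \<psi> y"
  by (rule order_trans[OF zero_le_power2 lyapunov_ge])

text \<open>The midpoint lies in \<open>K\<close> and has value at least \<open>m\<close>, so the
  gap is small. This serves both the Cauchy property of minimizing sequences and uniqueness.\<close>

lemma almost_minimizers_close:
  fixes K :: "'a::real_normed_vector set"
  assumes uc: "uniformly_convex TYPE('a)" and K: "convex K"
    and m: "\<And>z. z \<in> K \<Longrightarrow> m \<le> lyapunov \<psi> z" and e: "e > 0"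
  obtains s where "s > 0" "\<And>x y. \<lbrakk>x \<in> K; y \<in> K; lyapunov \<psi> x < m + s; lyapunov \<psi> y < m + s\<rbrakk>
    \<Longrightarrow> norm (x - y) < e"
proof -
  \<comment> \<open>\<open>R\<close> bounds the sublevel set of level \<open>m + 1\<close> through
    \<open>lyapunov_ge\<close>; the last 1 makes it positive.\<close>
  define R where "R = norm \<psi> + sqrt (\<bar>m\<bar> + 1) + 1"
  have R: "R > 0" by (simp add: R_def add_nonneg_pos)
  have bound: "norm x \<le> R" if "lyapunov \<psi> x < m + 1" for x
  proof -
    have "(norm \<psi> - norm x)\<^sup>2 \<le> \<bar>m\<bar> + 1" using lyapunov_ge[of \<psi> x] that by linarith
    then have "\<bar>norm \<psi> - norm x\<bar> \<le> sqrt (\<bar>m\<bar> + 1)"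
      using real_sqrt_le_mono by fastforce
    then show ?thesis by (simp add: R_def)
  qed
  obtain s where s: "s > 0" "\<And>x y::'a. \<lbrakk>norm x \<le> R; norm y \<le> R;
       ((norm x)\<^sup>2 + (norm y)\<^sup>2) / 2 - (norm ((1/2) *\<^sub>R (x + y)))\<^sup>2 < s\<rbrakk> \<Longrightarrow> norm (x - y) < e"
    using uniformly_convex_square_gap[OF uc e R] by blast
  show thesis
  \<comment> \<open>The cap 1 keeps both points in the sublevel set bounded by
    \<open>R\<close>.\<close>
  proof (rule that[of "min s 1"])
    fix x y
    assume xy: "x \<in> K" "y \<in> K" "lyapunov \<psi> x < m + min s 1" "lyapunov \<psi> y < m + min s 1"
    have "(1/2) *\<^sub>R (x + y) \<in> K"
      using convexD[OF K xy(1,2), of "1/2" "1/2"] by (simp add: scaleR_add_right)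
    then have "m \<le> lyapunov \<psi> ((1/2) *\<^sub>R (x + y))" by (rule m)
    then have "((norm x)\<^sup>2 + (norm y)\<^sup>2) / 2 - (norm ((1/2) *\<^sub>R (x + y)))\<^sup>2 < s"
      using lyapunov_midpoint[of \<psi> x y] xy(3,4) unfolding add_divide_distrib by linarith
    then show "norm (x - y) < e" using xy bound by (intro s(2)) auto
  qed (use s in simp)
qed

lemma lyapunov_minimizer_ex1:
  fixes K :: "'a::banach set"
  assumes uc: "uniformly_convex TYPE('a)" and K: "closed K" "convex K" "K \<noteq> {}"
  shows "\<exists>!y. y \<in> K \<and> (\<forall>z\<in>K. lyapunov \<psi> y \<le> lyapunov \<psi> z)"
proof -
  define m where "m = (INF z\<in>K. lyapunov \<psi> z)"
  have m: "m \<le> lyapunov \<psi> z" if "z \<in> K" for z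
    unfolding m_def using that lyapunov_ge_0 by (intro cINF_lower bdd_belowI2) auto
  have "\<exists>z\<in>K. lyapunov \<psi> z < m + s" if "s > 0" for s
    using that cINF_greatest[OF K(3), of "m + s" "lyapunov \<psi>"] by (fastforce simp: m_def not_le)
  then have "\<exists>z\<in>K. lyapunov \<psi> z < m + inverse (real (Suc n))" for n
    by simp
  then obtain Y where Y: "\<And>n. Y n \<in> K" "\<And>n. lyapunov \<psi> (Y n) < m + inverse (real (Suc n))"
    by metis
  have "Cauchy Y"
  proof (rule CauchyI)
    fix e :: real assume "e > 0"
    then obtain s where s: "s > 0" "\<And>x y. \<lbrakk>x \<in> K; y \<in> K; lyapunov \<psi> x < m + s; lyapunov \<psi> y < m + s\<rbrakk>
      \<Longrightarrow> norm (x - y) < e"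
      using almost_minimizers_close[OF uc K(2) m] by blast
    obtain N where N: "inverse (real (Suc N)) < s" using reals_Archimedean s(1) by blast
    have "lyapunov \<psi> (Y n) < m + s" if "n \<ge> N" for n
    proof -
      have "inverse (real (Suc n)) \<le> inverse (real (Suc N))" using that by (simp add: field_simps)
      then show ?thesis using Y(2)[of n] N by linarith
    qed
    then show "\<exists>M. \<forall>m\<ge>M. \<forall>n\<ge>M. norm (Y m - Y n) < e" using s(2) Y(1) by blast
  qed
  then obtain y where y: "Y \<longlonglongrightarrow> y" using Cauchy_convergent_iff convergent_def by blast
  have "y \<in> K" using closed_sequentially[OF K(1)] Y(1) y by blast
  have "(\<lambda>n. lyapunov \<psi> (Y n)) \<longlonglongrightarrow> lyapunov \<psi> y"
    unfolding lyapunov_def by (intro tendsto_intros y)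
  moreover have "(\<lambda>n. m + inverse (real (Suc n))) \<longlonglongrightarrow> m + 0"
    by (intro tendsto_intros LIMSEQ_inverse_real_of_nat)
  ultimately have "lyapunov \<psi> y \<le> m + 0"
    using Y(2) by (intro LIMSEQ_le) (auto intro: less_imp_le)
  then have min: "\<forall>z\<in>K. lyapunov \<psi> y \<le> lyapunov \<psi> z" using m by fastforce
  show ?thesis
  proof (rule ex1I[of _ y])
    show "y \<in> K \<and> (\<forall>z\<in>K. lyapunov \<psi> y \<le> lyapunov \<psi> z)" using \<open>y \<in> K\<close> min by blast
    fix x assume x: "x \<in> K \<and> (\<forall>z\<in>K. lyapunov \<psi> x \<le> lyapunov \<psi> z)"
    show "x = y"
    proof (rule ccontr)
      assume "x \<noteq> y"
      \<comment> \<open>With their own distance as the tolerance, two minimizers would be closer to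
        each other than they are.\<close>
      then have "norm (x - y) > 0" by simp
      then obtain s where "s > 0"
        "\<And>x' y'. \<lbrakk>x' \<in> K; y' \<in> K; lyapunov \<psi> x' < lyapunov \<psi> y + s; lyapunov \<psi> y' < lyapunov \<psi> y + s\<rbrakk>
          \<Longrightarrow> norm (x' - y') < norm (x - y)"
        using almost_minimizers_close[OF uc K(2), of "lyapunov \<psi> y" \<psi>] min by blast
      moreover have "lyapunov \<psi> x \<le> lyapunov \<psi> y" using x \<open>y \<in> K\<close> by blast
      ultimately show False using x \<open>y \<in> K\<close> by fastforce
    qed
  qed
qed

text \<open>Existence and uniqueness of the minimizer let the definite description be traded for
  minimality.\<close>

lemma gen_proj_eq_iff:
  fixes K :: "'a::banach set"
  assumes "uniformly_convex TYPE('a)" "closed K" "convex K" "v \<in> K"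
  shows "gen_proj K \<psi> = v \<longleftrightarrow> (\<forall>z\<in>K. lyapunov \<psi> v \<le> lyapunov \<psi> z)"
  using theI'[OF lyapunov_minimizer_ex1[of K \<psi>]] the1_equality[OF lyapunov_minimizer_ex1[of K \<psi>]] assms
  unfolding gen_proj_def by blast

section \<open>The variational inequality\<close>

lemma lyapunov_minimizer_iff:
  fixes K :: "'a::real_normed_vector set"
  assumes us: "uniformly_smooth TYPE('a)" and K: "convex K" "v \<in> K"
  shows "(\<forall>z\<in>K. lyapunov \<psi> v \<le> lyapunov \<psi> z) \<longleftrightarrow> \<psi> \<in> gen_dual_cone K v"
proof
  assume dual: "\<psi> \<in> gen_dual_cone K v"
  show "\<forall>z\<in>K. lyapunov \<psi> v \<le> lyapunov \<psi> z"
  proof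
    fix z assume "z \<in> K"
    \<comment> \<open>The difference \<open>lyapunov \<psi> z - lyapunov \<psi> v\<close> is twice
      the pairing of \<open>\<psi> - duality_map v\<close> with \<open>v - z\<close>, plus a
      remainder that is at least \<open>(norm v - norm z)\<^sup>2\<close>.\<close>
    let ?J = "blinfun_apply (duality_map v)"
    have "?J z \<le> norm v * norm z"
      using norm_blinfun[of "duality_map v" z] by (simp add: norm_duality_map[OF us])
    moreover have "2 * (norm v * norm z) \<le> (norm v)\<^sup>2 + (norm z)\<^sup>2"
      using sum_squares_bound[of "norm v" "norm z"] by simp
    moreover have "0 \<le> blinfun_apply \<psi> v - blinfun_apply \<psi> z - (norm v)\<^sup>2 + ?J z"
      using dual \<open>z \<in> K\<close> unfolding gen_dual_cone_def
      by (auto simp: blinfun.diff_left blinfun.diff_right duality_map_apply_self[OF us] algebra_simps)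
    ultimately show "lyapunov \<psi> v \<le> lyapunov \<psi> z" unfolding lyapunov_def by linarith
  qed
next
  assume min: "\<forall>z\<in>K. lyapunov \<psi> v \<le> lyapunov \<psi> z"
  show "\<psi> \<in> gen_dual_cone K v"
    unfolding gen_dual_cone_def
  proof safe
    fix z assume z: "z \<in> K"
    \<comment> \<open>Restriction to the segment from \<open>v\<close> to \<open>z\<close> reduces
      the claim to one variable: a negative derivative at 0 would give smaller values inside
      \<open>K\<close>.\<close>
    define \<phi> where "\<phi> t = lyapunov \<psi> (v + t *\<^sub>R (z - v))" for t
    have sq: "((\<lambda>x. (norm x)\<^sup>2) has_derivative (\<lambda>h. 2 * blinfun_apply (duality_map v) h))
        (at (v + 0 *\<^sub>R (z - v)))"
      using norm_square_has_derivative[OF us, of v] by simp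
    have line: "((\<lambda>t. v + t *\<^sub>R (z - v)) has_derivative (\<lambda>t. t *\<^sub>R (z - v))) (at 0)"
      by (auto intro!: derivative_eq_intros)
    have "(\<phi> has_derivative (\<lambda>t. - 2 * blinfun_apply \<psi> (t *\<^sub>R (z - v))
        + 2 * blinfun_apply (duality_map v) (t *\<^sub>R (z - v)))) (at 0)"
      unfolding \<phi>_def lyapunov_def
      by (rule derivative_eq_intros has_derivative_compose[OF line sq] line refl)+
        (simp add: fun_eq_iff)
    then have deriv: "(\<phi> has_real_derivative 2 * blinfun_apply (\<psi> - duality_map v) (v - z)) (at 0)"
      by (rule has_derivative_imp_has_field_derivative)
        (simp add: blinfun.diff_left blinfun.diff_right blinfun.scaleR_right algebra_simps)
    show "0 \<le> blinfun_apply (\<psi> - duality_map v) (v - z)"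
    proof (rule ccontr)
      assume "\<not> ?thesis"
      then obtain d where d: "d > 0" "\<And>h. \<lbrakk>0 < h; h < d\<rbrakk> \<Longrightarrow> \<phi> h < \<phi> 0"
        using DERIV_neg_dec_right[OF deriv] by auto
      \<comment> \<open>\<open>d / 2\<close> lies strictly inside the range of decrease, and the cap
        1 keeps the point on the segment.\<close>
      define h where "h = min (d / 2) 1"
      have h: "0 < h" "h < d" "h \<le> 1" using d(1) by (auto simp: h_def)
      have "v + h *\<^sub>R (z - v) \<in> K"
        using convexD_alt[OF K(1) K(2) z, of h] h by (simp add: algebra_simps)
      then have "\<phi> 0 \<le> \<phi> h" using min by (simp add: \<phi>_def)
      then show False using d(2) h by fastforce
    qed
  qed
qed

text \<open>Because \<open>v \<in> K\<close>, the supremum is at least the value at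
  \<open>v\<close>; only the upper bound is left to state, which removes the extended reals.\<close>

lemma mem_vision_iff:
  assumes "v \<in> K"
  shows "\<phi> \<in> vision K v \<longleftrightarrow> (\<forall>z\<in>K. blinfun_apply \<phi> z \<le> blinfun_apply \<phi> v)"
proof -
  have "ereal (blinfun_apply \<phi> v) \<le> (SUP z\<in>K. ereal (blinfun_apply \<phi> z))"
    using assms by (rule SUP_upper)
  then show ?thesis
    unfolding vision_def by (simp add: order.eq_iff[of "ereal _"] SUP_le_iff)
qed

lemma gen_dual_cone_eq_translated_vision:
  assumes "v \<in> K"
  shows "gen_dual_cone K v = {duality_map v + \<phi> | \<phi>. \<phi> \<in> vision K v}"
proof -
  have iff: "\<psi> \<in> gen_dual_cone K v \<longleftrightarrow> \<psi> - duality_map v \<in> vision K v" for \<psi>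
    by (simp add: gen_dual_cone_def mem_vision_iff[OF assms] blinfun.diff_right)
  have "\<psi> - duality_map v \<in> vision K v \<longleftrightarrow> (\<exists>\<phi>. \<psi> = duality_map v + \<phi> \<and> \<phi> \<in> vision K v)" for \<psi>
    by (metis add_diff_cancel_left' diff_add_cancel add.commute)
  then show ?thesis unfolding iff[symmetric] by blast
qed

theorem theorem5p19:
  fixes K :: "'a::banach set" and v :: 'a
  assumes "uniformly_convex TYPE('a)" and "uniformly_smooth TYPE('a)"
    and "closed K" and "convex K" and "cone_with_vertex K v"
  shows "gen_dual_cone K v = gen_proj K -` {v}
       \<and> gen_proj K -` {v} = {duality_map v + \<phi> | \<phi>. \<phi> \<in> vision K v}"
proof -
  have "v \<in> K" using assms(5) by (simp add: cone_with_vertex_def)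
  then have "gen_dual_cone K v = gen_proj K -` {v}"
    using gen_proj_eq_iff[OF assms(1,3,4)] lyapunov_minimizer_iff[OF assms(2,4)] by blast
  then show ?thesis using gen_dual_cone_eq_translated_vision[OF \<open>v \<in> K\<close>] by simp
qed

end
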